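(* Let $D$ be a discriminant form of type $2_{I\!I}^{\epsilon n}$ with $n$ even. Then \[\dim\mathbb C[D]^{\Gamma}=\frac{2^{n-1}+1}{3}+\epsilon\,2^{(n-2)/2}.\]
   Context: A discriminant form is a finite abelian group $D$ with a quadratic form $\operatorname{q}:D\to\mathbb Q/\mathbb Z$ whose associated bilinear form $(\beta,\gamma)=\operatorname{q}(\beta+\gamma)-\operatorname{q}(\beta)-\operatorname{q}(\gamma)$ is nondegenerate. $2_{I\!I}^{\epsilon n}$ ($n$ even) is the orthogonal sum of $n/2$ forms each generated by $\gamma,\delta$ of order $2$ with $(\gamma,\delta)=1/2$ and $\operatorname{q}(\gamma)=\operatorname{q}(\delta)=0$ (sign $+$) or $=1/2$ (sign $-$), $\epsilon$ the product of the signs; its signature $\operatorname{sign}(D)\in\mathbb Z/8\mathbb Z$ is even. $e(x)=e^{2\pi ix}$, $\Gamma=\operatorname{SL}_2(\mathbb Z)$; $\mathbb C[D]^\Gamma$ denotes the invariants of the Weil representation $\rho_D(T)e^\gamma=e(-\operatorname{q}(\gamma))e^\gamma$, $\rho_D(S)e^\gamma=\frac{e(\operatorname{sign}(D)/8)}{\sqrt{|D|}}\sum_\beta e((\gamma,\beta))e^\beta$. *)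

theory Defs
  imports "HOL-Analysis.Analysis" "HOL-Computational_Algebra.Group_Closure"
begin

section \<open>The group \<open>\<rat>/\<int>\<close>\<close>

quotient_type rat_mod_int = rat / "\<lambda>x y :: rat. x - y \<in> \<int>"
  morphisms rep_rat_mod_int qz
proof (rule equivpI)
  show "reflp (\<lambda>x y :: rat. x - y \<in> \<int>)"
    by (rule reflpI) simp
  show "symp (\<lambda>x y :: rat. x - y \<in> \<int>)"
    by (rule sympI) (metis Ints_minus minus_diff_eq)
  show "transp (\<lambda>x y :: rat. x - y \<in> \<int>)"
  proof (rule transpI)
    fix x y z :: rat
    assume "x - y \<in> \<int>" "y - z \<in> \<int>"
    from Ints_add[OF this] show "x - z \<in> \<int>" by simp
  qed
qed

instantiation rat_mod_int :: ab_group_add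
begin

lift_definition zero_rat_mod_int :: rat_mod_int is 0 .

lift_definition plus_rat_mod_int :: "rat_mod_int \<Rightarrow> rat_mod_int \<Rightarrow> rat_mod_int" is "(+)"
  by (metis Ints_add add_diff_add)

lift_definition uminus_rat_mod_int :: "rat_mod_int \<Rightarrow> rat_mod_int" is uminus
  by (metis Ints_minus minus_diff_minus)

lift_definition minus_rat_mod_int :: "rat_mod_int \<Rightarrow> rat_mod_int \<Rightarrow> rat_mod_int" is "(-)"
proof -
  fix a b c d :: rat
  assume "a - b \<in> \<int>" "c - d \<in> \<int>"
  from Ints_diff[OF this] show "a - c - (b - d) \<in> \<int>" by (simp add: algebra_simps)
qed

instance
  by standard (transfer; simp add: algebra_simps)+

end

text \<open>\<open>e(x) = exp(2 \<pi> i x)\<close>, a well-defined function on \<open>\<rat>/\<int>\<close>.\<close>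

lift_definition e :: "rat_mod_int \<Rightarrow> complex" is "\<lambda>x. exp (2 * of_real pi * \<i> * of_rat x)"
proof -
  fix x y :: rat
  assume "x - y \<in> \<int>"
  then obtain k :: int where "x - y = of_int k" by (auto elim: Ints_cases)
  then have "x = y + of_int k" by (simp add: algebra_simps)
  then have "2 * of_real pi * \<i> * of_rat x
      = 2 * of_real pi * \<i> * of_rat y + (of_int (2 * k) * pi) * \<i>"
    by (simp add: of_rat_add algebra_simps)
  then show "exp (2 * of_real pi * \<i> * of_rat x) = exp (2 * of_real pi * \<i> * of_rat y)"
    unfolding exp_eq by blast
qed

section \<open>Discriminant forms\<close>

definition int_mult :: "int \<Rightarrow> 'a::ab_group_add \<Rightarrow> 'a" where
  "int_mult k x = (if k \<ge> 0 then (\<Sum>i<nat k. x) else - (\<Sum>i<nat (- k). x))"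

definition bilin :: "('d::ab_group_add \<Rightarrow> rat_mod_int) \<Rightarrow> 'd \<Rightarrow> 'd \<Rightarrow> rat_mod_int" where
  "bilin q \<beta> \<gamma> = q (\<beta> + \<gamma>) - q \<beta> - q \<gamma>"

definition quadratic_form :: "('d::ab_group_add \<Rightarrow> rat_mod_int) \<Rightarrow> bool" where
  "quadratic_form q \<longleftrightarrow>
     (\<forall>k \<gamma>. q (int_mult k \<gamma>) = int_mult (k\<^sup>2) (q \<gamma>)) \<and>
     (\<forall>\<alpha> \<beta> \<gamma>. bilin q (\<alpha> + \<beta>) \<gamma> = bilin q \<alpha> \<gamma> + bilin q \<beta> \<gamma>) \<and>
     (\<forall>\<alpha> \<beta> \<gamma>. bilin q \<alpha> (\<beta> + \<gamma>) = bilin q \<alpha> \<beta> + bilin q \<alpha> \<gamma>)"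

text \<open>The finite abelian group \<open>D\<close> is the type \<open>'d\<close>.\<close>

definition discriminant_form :: "('d::{finite,ab_group_add} \<Rightarrow> rat_mod_int) \<Rightarrow> bool" where
  "discriminant_form q \<longleftrightarrow>
     quadratic_form q \<and> (\<forall>\<gamma>. (\<forall>\<beta>. bilin q \<gamma> \<beta> = 0) \<longrightarrow> \<gamma> = 0)"

text \<open>The signature in \<open>\<int>/8\<int>\<close>, represented in \<open>{0..<8}\<close>, is determined by
  Milgram's formula for the Gauss sum of \<open>D\<close>.\<close>

definition signature :: "('d::{finite,ab_group_add} \<Rightarrow> rat_mod_int) \<Rightarrow> int" where
  "signature q = (THE s. s \<in> {0..<8} \<and>
     (\<Sum>\<gamma>\<in>UNIV. e (q \<gamma>)) = of_real (sqrt (real CARD('d))) * e (qz (of_int s / 8)))"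

section \<open>Forms of type \<open>2\<^bsub>II\<^esub>\<^bsup>\<epsilon>n\<^esup>\<close>\<close>

definition orthogonal_sum ::
  "('d::ab_group_add \<Rightarrow> rat_mod_int) \<Rightarrow> nat \<Rightarrow> (nat \<Rightarrow> 'd set) \<Rightarrow> bool" where
  "orthogonal_sum q m H \<longleftrightarrow>
     (\<forall>i<m. \<forall>j<m. i \<noteq> j \<longrightarrow> (\<forall>x\<in>H i. \<forall>y\<in>H j. bilin q x y = 0)) \<and>
     (\<forall>x. \<exists>!h. h \<in> (\<Pi>\<^sub>E i\<in>{..<m}. H i) \<and> x = (\<Sum>i<m. h i))"

definition block_2II :: "('d::ab_group_add \<Rightarrow> rat_mod_int) \<Rightarrow> int \<Rightarrow> 'd set \<Rightarrow> bool" where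
  "block_2II q s H \<longleftrightarrow> (\<exists>\<gamma> \<delta>. H = group_closure {\<gamma>, \<delta>} \<and>
     \<gamma> \<noteq> 0 \<and> \<gamma> + \<gamma> = 0 \<and> \<delta> \<noteq> 0 \<and> \<delta> + \<delta> = 0 \<and>
     bilin q \<gamma> \<delta> = qz (1/2) \<and>
     (s = 1 \<and> q \<gamma> = 0 \<and> q \<delta> = 0 \<or> s = -1 \<and> q \<gamma> = qz (1/2) \<and> q \<delta> = qz (1/2)))"

definition type_2II ::
  "('d::{finite,ab_group_add} \<Rightarrow> rat_mod_int) \<Rightarrow> int \<Rightarrow> nat \<Rightarrow> bool" where
  "type_2II q \<epsilon> n \<longleftrightarrow> (\<exists>H s. orthogonal_sum q (n div 2) H \<and>
     (\<forall>i < n div 2. block_2II q (s i) (H i)) \<and> \<epsilon> = (\<Prod>i < n div 2. s i))"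

section \<open>The Weil representation\<close>

definition SL2Z :: "(int^2^2) set" where
  "SL2Z = {M. det M = 1}"

definition S_mat :: "int^2^2" where
  "S_mat = vector [vector [0, -1], vector [1, 0]]"

definition T_mat :: "int^2^2" where
  "T_mat = vector [vector [1, 1], vector [0, 1]]"

text \<open>The group algebra \<open>\<complex>[D]\<close> is \<open>complex^'d\<close>, with \<open>e\<^sup>\<gamma>\<close> the basis vector
  \<open>axis \<gamma> 1\<close>. A representation of \<open>SL\<^sub>2(\<int>)\<close> is determined by its values on \<open>S\<close> and \<open>T\<close>;
  extensionality fixes the irrelevant values outside \<open>SL\<^sub>2(\<int>)\<close>. For the existence,
  the signature has to be even.\<close>

definition is_weil_rep ::
  "('d::{finite,ab_group_add} \<Rightarrow> rat_mod_int) \<Rightarrow> (int^2^2 \<Rightarrow> (complex, 'd) vec \<Rightarrow> (complex, 'd) vec) \<Rightarrow> bool"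
  where
  "is_weil_rep q \<rho> \<longleftrightarrow>
     \<rho> \<in> extensional SL2Z \<and>
     (\<forall>M\<in>SL2Z. Vector_Spaces.linear (*s) (*s) (\<rho> M)) \<and>
     \<rho> (mat 1) = id \<and>
     (\<forall>M\<in>SL2Z. \<forall>N\<in>SL2Z. \<rho> (M ** N) = \<rho> M \<circ> \<rho> N) \<and>
     (\<forall>\<gamma>. \<rho> T_mat (axis \<gamma> 1) = e (- q \<gamma>) *s axis \<gamma> 1) \<and>
     (\<forall>\<gamma>. \<rho> S_mat (axis \<gamma> 1) =
        (e (qz (of_int (signature q) / 8)) / of_real (sqrt (real CARD('d)))) *s
          (\<Sum>\<beta>\<in>UNIV. e (bilin q \<gamma> \<beta>) *s axis \<beta> 1))"

definition weil_rep ::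
  "('d::{finite,ab_group_add} \<Rightarrow> rat_mod_int) \<Rightarrow> int^2^2 \<Rightarrow> (complex, 'd) vec \<Rightarrow> (complex, 'd) vec" where
  "weil_rep q = (THE \<rho>. is_weil_rep q \<rho>)"

definition weil_invariants ::
  "('d::{finite,ab_group_add} \<Rightarrow> rat_mod_int) \<Rightarrow> (complex, 'd) vec set" where
  "weil_invariants q = {v. \<forall>M\<in>SL2Z. weil_rep q M v = v}"

end

theory Submission
  imports Defs
begin

text \<open>
  The form takes values in \<open>{0, 1/2}\<close> on an elementary abelian 2-group, so \<open>\<rho>\<^sub>D(T)\<close> and
  \<open>\<rho>\<^sub>D(S)\<close> are involutions, and evaluating the Gauss sum \<open>\<epsilon> 2\<^bsup>n/2\<^esup>\<close> gives the braid relation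
  \<open>STS = TST\<close>. Hence the Weil representation factors through \<open>SL\<^sub>2(\<int>/2)\<close>, the symmetric group
  on three letters, and the dimension of the invariants is the average of the six traces: \<open>2\<^sup>n\<close> for
  the identity, \<open>\<epsilon> 2\<^bsup>n/2\<^esup>\<close> for the three conjugate involutions, and 1 for the two elements of
  order 3.
\<close>

section \<open>The character \<open>e\<close>\<close>

lemma e_zero [simp]: "e 0 = 1"
  by transfer simp

lemma e_add: "e (x + y) = e x * e y"
  by transfer (simp add: of_rat_add distrib_left exp_add)

lemma e_minus_mult_e: "e (- x) * e x = 1"
  by (metis e_add e_zero add.left_inverse)

lemma e_eq_1_iff: "e x = 1 \<longleftrightarrow> x = 0"
proof
  show "e x = 1 \<Longrightarrow> x = 0"
  proof transfer
    fix x :: rat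
    assume "exp (2 * of_real pi * \<i> * of_rat x) = 1"
    then obtain k :: int where "2 * pi * Re (of_rat x) = of_int (2 * k) * pi"
      unfolding exp_eq_1 by auto
    then have "Re (of_rat x) = real_of_int k" by simp
    moreover have "(of_rat x :: complex) = of_real (of_rat x)"
      by (cases x) (simp add: of_rat_rat)
    ultimately have "(of_rat x :: real) = of_rat (of_int k)" by simp
    then have "x = of_int k" by (simp only: of_rat_eq_iff)
    then show "x - 0 \<in> \<int>" by simp
  qed
qed simp

lemma e_half: "e (qz (1/2)) = -1"
  by transfer (simp add: of_rat_divide exp_pi_i algebra_simps)

lemma inj_e: "inj e"
proof (rule injI)
  fix x y assume "e x = e y"
  then have "e (x - y) = 1"
    by (metis add.right_inverse e_add e_zero diff_conv_add_uminus)
  then show "x = y" by (simp add: e_eq_1_iff)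
qed

section \<open>Traces of idempotents\<close>

lemma matrix_vector_mult_axis_nth:
  fixes A :: "'a::semiring_1^'n^'m"
  shows "(A *v axis j 1) $ i = A $ i $ j"
  by (simp add: matrix_vector_mult_def axis_def if_distrib cong: if_cong)

text \<open>The image of an idempotent is its fixed space, so \<open>P\<close> is expanded in a
  basis \<open>B\<close> of that space. After exchanging the sums, each \<open>b\<close> in
  \<open>B\<close> contributes the \<open>b\<close>-coordinate of \<open>P *v b = b\<close>, which
  is 1.\<close>

lemma trace_idempotent:
  fixes P :: "'a::field^'n^'n"
  assumes "P ** P = P"
  shows "trace P = of_nat (vec.dim {v. P *v v = v})"
proof -
  define V where "V = {v. P *v v = v}"
  obtain B where B: "B \<subseteq> V" "vec.independent B" "V \<subseteq> vec.span B" "card B = vec.dim V"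
    by (rule vec.basis_exists)
  have fin: "finite B" using B(2) by (rule vec.finiteI_independent)
  have "P *v (P *v v) = P *v v" for v
    using assms by (simp add: matrix_vector_mul_assoc)
  then have span: "P *v v \<in> vec.span B" for v
    using B(3) by (auto simp: V_def)
  define r where "r v = vec.representation B (P *v v)" for v
  have expand: "P *v v = (\<Sum>b\<in>B. r v b *s b)" for v
    unfolding r_def using vec.sum_representation_eq[OF B(2) span fin subset_refl] by simp
  have coord: "(\<Sum>i\<in>UNIV. b $ i * r (axis i 1) b) = 1" if "b \<in> B" for b
  proof -
    have "b = P *v b" using that B(1) by (auto simp: V_def)
    also have "\<dots> = P *v (\<Sum>i\<in>UNIV. b $ i *s axis i 1)" by (simp only: basis_expansion)
    also have "\<dots> = (\<Sum>i\<in>UNIV. b $ i *s (P *v axis i 1))"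
      by (simp only: vec.sum vec.scale)
    finally have "vec.representation B b b
        = vec.representation B (\<Sum>i\<in>UNIV. b $ i *s (P *v axis i 1)) b"
      by simp
    then show ?thesis
      using B(2) span that
      by (simp add: vec.representation_sum vec.span_scale vec.representation_scale
          vec.representation_basis r_def)
  qed
  have "trace P = (\<Sum>i\<in>UNIV. (P *v axis i 1) $ i)"
    by (simp add: trace_def matrix_vector_mult_axis_nth)
  also have "\<dots> = (\<Sum>i\<in>UNIV. \<Sum>b\<in>B. r (axis i 1) b * b $ i)"
    by (simp add: expand)
  also have "\<dots> = (\<Sum>b\<in>B. \<Sum>i\<in>UNIV. b $ i * r (axis i 1) b)"
    by (subst sum.swap) (simp add: mult.commute)
  also have "\<dots> = of_nat (card B)" by (simp add: coord)
  finally show ?thesis using B(4) by (simp add: V_def)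
qed

section \<open>Generators of \<open>SL\<^sub>2(\<int>)\<close>\<close>

lemma mat2_eqI:
  fixes M N :: "'a^2^2"
  assumes "M$1$1 = N$1$1" "M$1$2 = N$1$2" "M$2$1 = N$2$1" "M$2$2 = N$2$2"
  shows "M = N"
  using assms by (simp add: vec_eq_iff forall_2)

lemma mat2_mult_nth:
  fixes M N :: "'a::semiring_1^2^2"
  shows "(M ** N)$i$j = M$i$1 * N$1$j + M$i$2 * N$2$j"
  by (simp add: matrix_matrix_mult_def sum_2)

lemma S_mat_nth [simp]: "S_mat$1$1 = 0" "S_mat$1$2 = -1" "S_mat$2$1 = 1" "S_mat$2$2 = 0"
  by (simp_all add: S_mat_def)

lemma T_mat_nth [simp]: "T_mat$1$1 = 1" "T_mat$1$2 = 1" "T_mat$2$1 = 0" "T_mat$2$2 = 1"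
  by (simp_all add: T_mat_def)

lemma mat1_2_nth [simp]:
  "(mat 1 :: 'a::{zero,one}^2^2)$1$1 = 1" "(mat 1 :: 'a^2^2)$1$2 = 0"
  "(mat 1 :: 'a^2^2)$2$1 = 0" "(mat 1 :: 'a^2^2)$2$2 = 1"
  by (simp_all add: mat_def)

lemma SL2Z_iff: "M \<in> SL2Z \<longleftrightarrow> M$1$1 * M$2$2 - M$1$2 * M$2$1 = 1"
  by (simp add: SL2Z_def det_2)

lemma mat1_in_SL2Z [simp]: "mat 1 \<in> SL2Z"
  and S_mat_in_SL2Z [simp]: "S_mat \<in> SL2Z"
  and T_mat_in_SL2Z [simp]: "T_mat \<in> SL2Z"
  by (simp_all add: SL2Z_iff)

lemma SL2Z_mult [simp]: "M \<in> SL2Z \<Longrightarrow> N \<in> SL2Z \<Longrightarrow> M ** N \<in> SL2Z"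
  by (simp add: SL2Z_def det_mul)

definition T_pow :: "int \<Rightarrow> int^2^2" where
  "T_pow k = vector [vector [1, k], vector [0, 1]]"

lemma T_pow_nth [simp]: "T_pow k$1$1 = 1" "T_pow k$1$2 = k" "T_pow k$2$1 = 0" "T_pow k$2$2 = 1"
  by (simp_all add: T_pow_def)

lemma T_pow_in_SL2Z [simp]: "T_pow k \<in> SL2Z"
  by (simp add: SL2Z_iff)

text \<open>Euclid's algorithm on the first column. Only multiplications by \<open>S\<close> and \<open>T\<close>
  themselves are needed, since \<open>S\<^sup>4 = (ST)\<^sup>6 = 1\<close>.\<close>

lemma SL2Z_induct [consumes 1, case_names one S T]:
  assumes "M \<in> SL2Z" and one: "P (mat 1)"
    and S: "\<And>N. N \<in> SL2Z \<Longrightarrow> P N \<Longrightarrow> P (S_mat ** N)"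
    and T: "\<And>N. N \<in> SL2Z \<Longrightarrow> P N \<Longrightarrow> P (T_mat ** N)"
  shows "P M"
proof -
  have T_inv: "P (T_pow (-1) ** N)" if "N \<in> SL2Z" "P N" for N
  proof -
    \<comment> \<open>This is (ST)^3 = S^2 solved for the inverse of T, using S^4 = 1.\<close>
    have "T_pow (-1) ** N
        = S_mat ** (S_mat ** (S_mat ** (T_mat ** (S_mat ** (T_mat ** (S_mat ** N))))))"
      by (rule mat2_eqI) (simp_all add: mat2_mult_nth)
    then show ?thesis using that by (simp add: S T)
  qed
  have T_pow: "P (T_pow k ** N)" if "N \<in> SL2Z" "P N" for k N
  proof (induction k rule: int_induct[where k = 0])
    case base
    have "T_pow 0 ** N = N" by (rule mat2_eqI) (simp_all add: mat2_mult_nth)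
    then show ?case using that by simp
  next
    case (step1 k)
    have "T_pow (k + 1) ** N = T_mat ** (T_pow k ** N)"
      by (rule mat2_eqI) (simp_all add: mat2_mult_nth algebra_simps)
    then show ?case using that step1 by (simp add: T)
  next
    case (step2 k)
    have "T_pow (k - 1) ** N = T_pow (-1) ** (T_pow k ** N)"
      by (rule mat2_eqI) (simp_all add: mat2_mult_nth algebra_simps)
    then show ?case using that step2 by (simp add: T_inv)
  qed
  show ?thesis using assms(1)
  proof (induction "nat \<bar>M$2$1\<bar>" arbitrary: M rule: less_induct)
    case less
    show ?case
    proof (cases "M$2$1 = 0")
      case True
      then have "M$1$1 * M$2$2 = 1" using less.prems by (simp add: SL2Z_iff)
      then consider "M$1$1 = 1" "M$2$2 = 1" | "M$1$1 = -1" "M$2$2 = -1"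
        by (auto simp: zmult_eq_1_iff)
      then show ?thesis
      proof cases
        case 1
        then have "M = T_pow (M$1$2) ** mat 1"
          using True by (intro mat2_eqI) (simp_all add: mat2_mult_nth)
        then show ?thesis using one T_pow by (metis mat1_in_SL2Z)
      next
        case 2
        then have "M = S_mat ** (S_mat ** (T_pow (- M$1$2) ** mat 1))"
          using True by (intro mat2_eqI) (simp_all add: mat2_mult_nth)
        then show ?thesis using one T_pow S
          by (metis mat1_in_SL2Z SL2Z_mult T_pow_in_SL2Z S_mat_in_SL2Z)
      qed
    next
      case False
      \<comment> \<open>One Euclidean step: \<open>T_pow (- k)\<close> reduces the upper left entry
        modulo the lower left one, and S moves the remainder to the lower left.\<close>
      define k where "k = M$1$1 div M$2$1"
      define N where "N = S_mat ** (T_pow (- k) ** M)"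
      have N: "N \<in> SL2Z" using less.prems by (simp add: N_def)
      have "N$2$1 = M$1$1 mod M$2$1"
        by (simp add: N_def mat2_mult_nth k_def minus_div_mult_eq_mod [symmetric])
      then have "nat \<bar>N$2$1\<bar> < nat \<bar>M$2$1\<bar>"
        using False abs_mod_less by simp
      then have "P N" using less.hyps N by blast
      moreover have "M = T_pow k ** (S_mat ** (S_mat ** (S_mat ** N)))"
        unfolding N_def by (rule mat2_eqI) (simp_all add: mat2_mult_nth algebra_simps)
      ultimately show ?thesis using N S T_pow by (metis SL2Z_mult S_mat_in_SL2Z)
    qed
  qed
qed

section \<open>Representations factoring through \<open>SL\<^sub>2(\<int>/2)\<close>\<close>

text \<open>Reduction modulo 2 identifies \<open>SL\<^sub>2(\<int>/2)\<close> with the symmetric group on three letters,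
  presented by \<open>S\<^sup>2 = T\<^sup>2 = 1\<close> and \<open>TST = STS\<close>.\<close>

definition mod2_word :: "'a::comm_ring_1^'n^'n \<Rightarrow> 'a^'n^'n \<Rightarrow> int^2^2 \<Rightarrow> 'a^'n^'n" where
  "mod2_word S T M =
     (if even (M$1$1) then (if even (M$2$2) then S else S ** T)
      else if even (M$1$2) then (if even (M$2$1) then mat 1 else S ** (T ** S))
      else (if even (M$2$1) then T else T ** S))"

locale braid_involutions =
  fixes S T :: "'a::field_char_0^'n^'n"
  assumes SS: "S ** S = mat 1" and TT: "T ** T = mat 1"
    and braid: "T ** (S ** T) = S ** (T ** S)"
begin

text \<open>The trailing \<open>X\<close> lets the relations act inside right-nested products;
  rewriting then leaves only the words 1, S, T, ST, TS, STS.\<close>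

lemma SS_left: "S ** (S ** X) = X" and TT_left: "T ** (T ** X) = X"
  and braid_left: "T ** (S ** (T ** X)) = S ** (T ** (S ** X))"
  using SS TT braid by (simp_all add: matrix_mul_assoc)

lemmas word_simps = SS TT braid SS_left TT_left braid_left matrix_mul_assoc[symmetric]

lemma mod2_word_mult:
  assumes "M \<in> SL2Z" "N \<in> SL2Z"
  shows "mod2_word S T (M ** N) = mod2_word S T M ** mod2_word S T N"
proof -
  \<comment> \<open>Odd determinant leaves 6 of the 16 parity patterns for each factor, hence 36
    products to compare.\<close>
  have "odd (M$1$1 * M$2$2 - M$1$2 * M$2$1)" "odd (N$1$1 * N$2$2 - N$1$2 * N$2$1)"
    using assms by (simp_all add: SL2Z_iff)
  then show ?thesis
    unfolding mod2_word_def mat2_mult_nth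
    by (cases "even (M$1$1)"; cases "even (M$1$2)"; cases "even (M$2$1)"; cases "even (M$2$2)";
        cases "even (N$1$1)"; cases "even (N$1$2)"; cases "even (N$2$1)"; cases "even (N$2$2)";
        simp add: word_simps)
qed

text \<open>The average \<open>P\<close> of the six words projects onto the common fixed space,
  whose dimension is therefore its trace. The involutions S, T, STS have equal traces, and so do ST
  and TS.\<close>

lemma dim_fixed:
  "of_nat (vec.dim {v. S *v v = v \<and> T *v v = v})
     = (of_nat CARD('n) + 3 * trace T + 2 * trace (S ** T)) / (6 :: 'a)"
proof -
  define Q where "Q = mat 1 + S + T + S ** T + T ** S + S ** (T ** S)"
  define P where "P = (\<chi> i j. Q $ i $ j / 6)"
  have scale: "A ** P = (\<chi> i j. (A ** Q) $ i $ j / 6)" for A :: "'a^'n^'n"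
    by (simp add: P_def matrix_matrix_mult_def vec_eq_iff sum_divide_distrib)
  \<comment> \<open>Left multiplication by S or T permutes the six summands.\<close>
  have "S ** Q = Q" "T ** Q = Q"
    unfolding Q_def by (simp_all add: matrix_add_ldistrib word_simps algebra_simps)
  then have SP: "S ** P = P" and TP: "T ** P = P"
    unfolding scale by (simp_all add: P_def)
  have P_vec: "P *v v = (1/6) *s
      (v + S *v v + T *v v + S *v (T *v v) + T *v (S *v v) + S *v (T *v (S *v v)))" for v
  proof -
    have "P *v v = (1/6) *s (Q *v v)"
      by (simp add: P_def matrix_vector_mult_def vec_eq_iff sum_distrib_left mult.assoc)
    then show ?thesis
      by (simp add: Q_def matrix_vector_mult_add_rdistrib matrix_vector_mul_assoc)
  qed
  have fixed: "P *v v = v \<longleftrightarrow> S *v v = v \<and> T *v v = v" for v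
  proof
    assume "P *v v = v"
    then show "S *v v = v \<and> T *v v = v"
      by (metis SP TP matrix_vector_mul_assoc)
  next
    assume "S *v v = v \<and> T *v v = v"
    then have "P *v v = (1/6) *s (v + v + v + v + v + v)" by (simp only: P_vec)
    then show "P *v v = v" by (simp add: vec_eq_iff)
  qed
  \<comment> \<open>Every \<open>P *v v\<close> is fixed by S and T, hence by
    \<open>P\<close>.\<close>
  have "P ** P = P"
    unfolding matrix_eq by (metis SP TP fixed matrix_vector_mul_assoc)
  then have "of_nat (vec.dim {v. S *v v = v \<and> T *v v = v}) = trace P"
    by (simp add: trace_idempotent fixed)
  also have "\<dots> = trace Q / 6"
    by (simp add: trace_def P_def sum_divide_distrib)
  also have "trace (S ** (T ** S)) = trace T"
    by (simp add: trace_mul_sym[of S] word_simps)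
  then have "trace Q = of_nat CARD('n) + trace S + 2 * trace T + 2 * trace (S ** T)"
    by (simp add: Q_def trace_add trace_I trace_mul_sym[of T S])
  \<comment> \<open>Cyclicity reduces the trace of TST to that of S, and the trace of STS to that of
    T.\<close>
  also have "trace S = trace T"
    using trace_mul_sym[of T "S ** T"] by (simp add: word_simps trace_mul_sym[of S "T ** S"])
  finally show ?thesis by (simp add: algebra_simps)
qed

end

section \<open>Forms of type \<open>2\<^bsub>II\<^esub>\<^bsup>\<epsilon>n\<^esup>\<close>\<close>

lemma quadratic_form_zero: "quadratic_form q \<Longrightarrow> q 0 = 0"
proof -
  assume "quadratic_form q"
  then have "q (int_mult 0 0) = int_mult (0\<^sup>2) (q 0)" unfolding quadratic_form_def by blast
  then show ?thesis by (simp add: int_mult_def)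
qed

lemma e_quadratic_add: "e (q (x + y)) = e (q x) * e (q y) * e (bilin q x y)"
  by (simp add: e_add [symmetric] bilin_def)

lemma bilin_commute: "bilin q x y = bilin q y x"
  by (simp add: bilin_def add.commute algebra_simps)

lemma bilin_sum_left:
  assumes "quadratic_form q"
  shows "bilin q (\<Sum>i\<in>I. f i) y = (\<Sum>i\<in>I. bilin q (f i) y)"
proof -
  have "bilin q 0 y = 0" using assms by (simp add: bilin_def quadratic_form_zero)
  then show ?thesis using assms
    by (induction I rule: infinite_finite_induct) (simp_all add: quadratic_form_def)
qed

lemma group_closure_two_involutions:
  fixes x y :: "'a::ab_group_add"
  assumes "x + x = 0" "y + y = 0"
  shows "group_closure {x, y} = {0, x, y, x + y}"
proof
  have "- x = x" "- y = y" using assms by (simp_all add: minus_unique)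
  \<comment> \<open>\<open>group_closure\<close> is built from differences, which become sums
    because \<open>x\<close> and \<open>y\<close> are their own negatives.\<close>
  then have "z - x = z + x" "z - y = z + y" for z
    by (metis diff_conv_add_uminus)+
  have absorb: "x + (x + z) = z" "y + (y + z) = z" for z
    using assms by (simp_all add: add.assoc [symmetric])
  have "z \<in> {0, x, y, x + y}" if "z \<in> group_closure {x, y}" for z
    using that
  proof induction
    case (diff s t)
    then show ?case
      by (elim insertE emptyE; simp add: \<open>\<And>z. z - x = z + x\<close> \<open>\<And>z. z - y = z + y\<close>
          diff_diff_eq [symmetric] assms absorb ac_simps)
  qed auto
  then show "group_closure {x, y} \<subseteq> {0, x, y, x + y}" by blast
  show "{0, x, y, x + y} \<subseteq> group_closure {x, y}"
    by (auto intro: group_closure.base group_closure_add)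
qed

text \<open>On 0, \<gamma>, \<delta>, \<gamma> + \<delta> the function \<open>e (q x)\<close> takes
  the values 1, s, s, -1, so a block has Gauss sum 2s.\<close>

lemma block_2II_properties:
  assumes q: "quadratic_form q" and "block_2II q s H"
  shows "x \<in> H \<Longrightarrow> x + x = 0"
    and "x \<in> H \<Longrightarrow> e (q x) = 1 \<or> e (q x) = -1"
    and "(\<Sum>x\<in>H. e (q x)) = 2 * of_int s"
    and "finite H" and "s = 1 \<or> s = -1"
proof -
  obtain \<gamma> \<delta> where H: "H = group_closure {\<gamma>, \<delta>}"
    and \<gamma>: "\<gamma> \<noteq> 0" "\<gamma> + \<gamma> = 0" and \<delta>: "\<delta> \<noteq> 0" "\<delta> + \<delta> = 0" and b: "bilin q \<gamma> \<delta> = qz (1/2)"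
    and s: "s = 1 \<and> q \<gamma> = 0 \<and> q \<delta> = 0 \<or> s = -1 \<and> q \<gamma> = qz (1/2) \<and> q \<delta> = qz (1/2)"
    using assms(2) unfolding block_2II_def by blast
  have H: "H = {0, \<gamma>, \<delta>, \<gamma> + \<delta>}"
    using H group_closure_two_involutions \<gamma>(2) \<delta>(2) by blast
  have val: "e (q 0) = 1" "e (q \<gamma>) = of_int s" "e (q \<delta>) = of_int s" "e (q (\<gamma> + \<delta>)) = -1"
    using s by (auto simp: quadratic_form_zero[OF q] e_half e_quadratic_add b)
  have "\<gamma> \<noteq> \<delta>"
  proof
    assume "\<gamma> = \<delta>"
    then have "e (q (\<gamma> + \<delta>)) = 1" using \<gamma> by (simp add: val)
    then show False by (simp add: val)
  qed
  then have dist: "\<gamma> + \<delta> \<noteq> 0" "\<gamma> \<noteq> \<delta>"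
    using \<gamma> by (metis add_left_cancel)+
  show "s = 1 \<or> s = -1" using s by blast
  then show "x \<in> H \<Longrightarrow> e (q x) = 1 \<or> e (q x) = -1" using val H by auto
  have "\<gamma> + \<delta> + (\<gamma> + \<delta>) = (\<gamma> + \<gamma>) + (\<delta> + \<delta>)" by (simp only: ac_simps)
  then show "x \<in> H \<Longrightarrow> x + x = 0" using \<gamma> \<delta> H by auto
  show "finite H" by (simp add: H)
  show "(\<Sum>x\<in>H. e (q x)) = 2 * of_int s"
    using \<gamma> \<delta> dist dist(1)[symmetric] by (simp add: H val)
qed

text \<open>Collects the consequences of the block decomposition from which the representation is
  computed; \<open>m\<close> stands for n/2.\<close>

locale weil_2II =
  fixes q :: "'d::{finite,ab_group_add} \<Rightarrow> rat_mod_int" and \<epsilon> :: int and m :: nat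
  assumes disc: "discriminant_form q"
    and double: "x + x = (0::'d)"
    and q_sign: "e (q x) = 1 \<or> e (q x) = -1"
    and gauss: "(\<Sum>x\<in>UNIV. e (q x)) = of_int \<epsilon> * 2 ^ m"
    and eps: "\<epsilon> = 1 \<or> \<epsilon> = -1"

text \<open>Since \<open>e (q x)\<close> is multiplicative over orthogonal summands, the Gauss sum
  of D is the product of the Gauss sums \<open>2 * s i\<close> of the blocks.\<close>

lemma type_2II_imp_weil_2II:
  fixes q :: "'d::{finite,ab_group_add} \<Rightarrow> rat_mod_int"
  assumes disc: "discriminant_form q" and "type_2II q \<epsilon> n"
  shows "weil_2II q \<epsilon> (n div 2)"
proof -
  define m where "m = n div 2"
  have q: "quadratic_form q" using disc by (simp add: discriminant_form_def)
  obtain H s where orth: "orthogonal_sum q m H"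
    and block: "\<And>i. i < m \<Longrightarrow> block_2II q (s i) (H i)" and \<epsilon>: "\<epsilon> = (\<Prod>i<m. s i)"
    using assms(2) unfolding type_2II_def m_def by blast
  note block_props = block_2II_properties[OF q block]
  define F where "F = (\<Pi>\<^sub>E i\<in>{..<m}. H i)"
  have unique: "\<exists>!h. h \<in> F \<and> x = (\<Sum>i<m. h i)" for x
    using orth by (simp add: orthogonal_sum_def F_def)
  \<comment> \<open>Induction on partial sums: each one is orthogonal to the next component.\<close>
  have prod: "e (q (\<Sum>i<k. h i)) = (\<Prod>i<k. e (q (h i)))" if "h \<in> F" "k \<le> m" for h k
    using that(2)
  proof (induction k)
    case 0
    then show ?case by (simp add: quadratic_form_zero[OF q])
  next
    case (Suc k)
    have "bilin q (h i) (h k) = 0" if "i < k" for i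
    proof -
      have "h i \<in> H i" "h k \<in> H k" 
        using \<open>h \<in> F\<close> that Suc.prems unfolding F_def by (simp_all add: PiE_mem)
      then show ?thesis 
        using orth that Suc.prems unfolding orthogonal_sum_def
        by (metis Suc_le_lessD less_irrefl less_trans)
    qed
    then have "bilin q (\<Sum>i<k. h i) (h k) = 0" by (simp add: bilin_sum_left[OF q])
    then show ?case using Suc by (simp add: e_quadratic_add)
  qed
  \<comment> \<open>Unique decomposition lets a sum over D be taken over families of block
    elements.\<close>
  have bij: "bij_betw (\<lambda>h. \<Sum>i<m. h i) F UNIV"
  proof (rule bij_betwI')
    have "h = g" if "h \<in> F" "g \<in> F" "(\<Sum>i<m. h i) = (\<Sum>i<m. g i)" for h g
    proof (rule ex1E[OF unique[of "\<Sum>i<m. h i"]])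
      fix k assume all: "\<forall>g. g \<in> F \<and> (\<Sum>i<m. h i) = (\<Sum>i<m. g i) \<longrightarrow> g = k"
      have "h = k" using all[rule_format, of h] that(1) by simp
      moreover have "g = k" using all[rule_format, of g] that(2,3) by simp
      ultimately show "h = g" by simp
    qed
    then show "(\<Sum>i<m. h i) = (\<Sum>i<m. g i) \<longleftrightarrow> h = g" if "h \<in> F" "g \<in> F" for h g
      using that by metis
    show "\<exists>h\<in>F. x = (\<Sum>i<m. h i)" for x
      using ex1_implies_ex[OF unique[of x]] by blast
  qed simp
  show ?thesis unfolding m_def [symmetric]
  proof
    show "discriminant_form q" by fact
    show "x + x = 0" for x :: 'd
    proof -
      obtain h where h: "h \<in> F" "x = (\<Sum>i<m. h i)"
        using ex1_implies_ex[OF unique[of x]] by blast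
      then have "h i + h i = 0" if "i < m" for i
        using that block_props(1)[of i "h i"] by (simp add: F_def PiE_mem)
      then show ?thesis by (simp add: h(2) sum.distrib [symmetric])
    qed
    show "e (q x) = 1 \<or> e (q x) = -1" for x
    proof -
      obtain h where h: "h \<in> F" "x = (\<Sum>i<m. h i)"
        using ex1_implies_ex[OF unique[of x]] by blast
      have "e (q (h i)) = 1 \<or> e (q (h i)) = -1" if "i < m" for i
        using h that block_props(2)[of i "h i"] by (simp add: F_def PiE_mem)
      then have "(\<Prod>i<k. e (q (h i))) = 1 \<or> (\<Prod>i<k. e (q (h i))) = -1" if "k \<le> m" for k
        using that by (induction k) (force simp: Suc_le_eq)+
      then show ?thesis using prod[OF h(1) order_refl] h(2) by simp
    qed
    show "\<epsilon> = 1 \<or> \<epsilon> = -1"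
    proof -
      have "(\<Prod>i<k. s i) = 1 \<or> (\<Prod>i<k. s i) = -1" if "k \<le> m" for k
        using that
      proof (induction k)
        case (Suc k)
        then show ?case using block_props(5)[of k] by auto
      qed simp
      then show ?thesis by (simp add: \<epsilon>)
    qed
    have "(\<Sum>x\<in>UNIV. e (q x)) = (\<Sum>h\<in>F. e (q (\<Sum>i<m. h i)))"
      using sum.reindex_bij_betw[OF bij, of "\<lambda>x. e (q x)"] by simp
    also have "\<dots> = (\<Sum>h\<in>F. \<Prod>i<m. e (q (h i)))"
      by (simp add: prod)
    also have "\<dots> = (\<Prod>i<m. \<Sum>x\<in>H i. e (q x))"
      unfolding F_def by (rule prod_sum_PiE [symmetric]) (simp_all add: block_props(4))
    also have "\<dots> = (\<Prod>i<m. 2 * of_int (s i))"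
      by (simp add: block_props(3))
    finally show "(\<Sum>x\<in>UNIV. e (q x)) = of_int \<epsilon> * 2 ^ m"
      by (simp add: \<epsilon> prod.distrib mult.commute)
  qed
qed

section \<open>The Weil representation and its invariants\<close>

context weil_2II
begin

section \<open>Character sums, the order of D and its signature\<close>

lemma quadratic: "quadratic_form q"
  using disc by (simp add: discriminant_form_def)

lemma q_sq [simp]: "e (q x) * e (q x) = 1"
  using q_sign[of x] by auto

lemma q_sq_left [simp]: "e (q x) * (e (q x) * z) = z"
  by (simp add: mult.assoc [symmetric])

lemma e_minus_q: "e (- q x) = e (q x)"
  by (metis e_minus_mult_e q_sq mult.assoc mult_1_left mult_1_right)

lemma e_bilin_add_right: "e (bilin q x (y + z)) = e (bilin q x y) * e (bilin q x z)"
  using quadratic by (simp add: quadratic_form_def e_add)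

lemma e_bilin_add_left: "e (bilin q (x + y) z) = e (bilin q x z) * e (bilin q y z)"
  using quadratic by (simp add: quadratic_form_def e_add)

lemma e_bilin_eq: "e (bilin q x y) = e (q (x + y)) * e (q x) * e (q y)"
  using q_sq[of x] q_sq[of y] by (simp add: e_quadratic_add algebra_simps)

lemma e_bilin_self [simp]: "e (bilin q x x) = 1"
  by (simp add: e_bilin_eq double quadratic_form_zero[OF quadratic])

lemma add_eq_0_iff: "x + y = 0 \<longleftrightarrow> x = (y::'d)"
  by (metis double add_right_cancel)

text \<open>Orthogonality of characters: for nonzero \<open>x\<close>, nondegeneracy gives
  \<open>z\<close> with \<open>e (bilin q x z)\<close> different from 1, and translation by
  \<open>z\<close> multiplies the sum by this factor.\<close>

lemma sum_e_bilin: "(\<Sum>y\<in>UNIV. e (bilin q x y)) = (if x = 0 then of_nat CARD('d) else 0)"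
proof (cases "x = 0")
  case True
  then show ?thesis by (simp add: bilin_def quadratic_form_zero[OF quadratic])
next
  case False
  then obtain z where "bilin q x z \<noteq> 0"
    using disc unfolding discriminant_form_def by blast
  then have z: "e (bilin q x z) \<noteq> 1" by (simp add: e_eq_1_iff)
  have "(\<Sum>y\<in>UNIV. e (bilin q x y)) = (\<Sum>y\<in>UNIV. e (bilin q x (y + z)))"
    by (rule sum.reindex_bij_betw [symmetric]) (simp add: bij_plus_right)
  also have "\<dots> = e (bilin q x z) * (\<Sum>y\<in>UNIV. e (bilin q x y))"
    by (simp add: e_bilin_add_right sum_distrib_left mult.commute)
  finally show ?thesis using z False by simp
qed

text \<open>Completing the square: as \<open>e (q x)\<close> is its own inverse, the summand is
  \<open>e (q x) * e (q (x + y))\<close>, and translation gives the Gauss sum.\<close>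

lemma sum_e_bilin_q: "(\<Sum>y\<in>UNIV. e (bilin q x y) * e (q y)) = e (q x) * (of_int \<epsilon> * 2 ^ m)"
proof -
  have "(\<Sum>y\<in>UNIV. e (bilin q x y) * e (q y)) = (\<Sum>y\<in>UNIV. e (q x) * e (q (x + y)))"
    by (simp add: e_bilin_eq mult_ac)
  also have "\<dots> = e (q x) * (\<Sum>y\<in>UNIV. e (q (x + y)))" by (simp add: sum_distrib_left)
  also have "(\<Sum>y\<in>UNIV. e (q (x + y))) = (\<Sum>y\<in>UNIV. e (q y))"
    by (rule sum.reindex_bij_betw) (simp add: bij_plus_right)
  finally show ?thesis by (simp add: gauss)
qed

lemma eps_sq [simp]: "of_int \<epsilon> * of_int \<epsilon> = (1 :: complex)"
  using eps by auto

lemma eps_sq_left [simp]: "of_int \<epsilon> * (of_int \<epsilon> * z) = (z :: complex)"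
  by (simp add: mult.assoc [symmetric])

text \<open>Sum \<open>e((x,y)) e(q(y))\<close> over both variables in the two possible orders.\<close>

lemma card_eq: "CARD('d) = 4 ^ m"
proof -
  have "(of_int \<epsilon> * 2 ^ m) * (of_int \<epsilon> * 2 ^ m)
      = (\<Sum>x\<in>UNIV. \<Sum>y\<in>UNIV. e (bilin q x y) * e (q y))"
    by (simp add: sum_e_bilin_q sum_distrib_right [symmetric] gauss)
  also have "\<dots> = (\<Sum>y\<in>UNIV. (\<Sum>x\<in>UNIV. e (bilin q y x)) * e (q y))"
    by (subst sum.swap) (simp add: sum_distrib_right bilin_commute)
  also have "\<dots> = (\<Sum>y\<in>(UNIV :: 'd set). if y = 0 then of_nat CARD('d) else 0)"
    by (rule arg_cong[where f = "\<lambda>f. sum f UNIV"])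
      (auto simp: sum_e_bilin quadratic_form_zero[OF quadratic])
  also have "\<dots> = of_nat CARD('d)" by simp
  also have "(of_int \<epsilon> * 2 ^ m) * (of_int \<epsilon> * 2 ^ m) = complex_of_nat (4 ^ m)"
    using eps by (auto simp: power_mult_distrib [symmetric])
  finally show ?thesis using of_nat_eq_iff by metis
qed

lemma sqrt_card: "sqrt (real CARD('d)) = 2 ^ m"
  by (simp add: card_eq real_sqrt_power)

text \<open>The Gauss sum is \<epsilon> times the square root of |D|, so the signature is 0 or 4.
  Injectivity of \<open>e\<close> makes it unique in \<open>{0..<8}\<close>, which the definite
  description requires.\<close>

lemma e_signature: "e (qz (of_int (signature q) / 8)) = of_int \<epsilon>"
proof -
  define Q where "Q s \<longleftrightarrow> s \<in> {0..<8} \<and>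
     (\<Sum>\<gamma>\<in>UNIV. e (q \<gamma>)) = of_real (sqrt (real CARD('d))) * e (qz (of_int s / 8))" for s :: int
  have Q: "Q s \<longleftrightarrow> s \<in> {0..<8} \<and> e (qz (of_int s / 8)) = of_int \<epsilon>" for s
    by (auto simp: Q_def gauss sqrt_card)
  have "qz (0 / 8) = 0" by (simp add: zero_rat_mod_int_def)
  then have "Q (if \<epsilon> = 1 then 0 else 4)"
    using eps by (auto simp: Q e_half)
  moreover have "s = t" if "Q s" "Q t" for s t
  proof -
    have "qz (of_int s / 8) = qz (of_int t / 8)" using that by (auto simp: Q intro: injD[OF inj_e])
    then have "(of_int s / 8 - of_int t / 8 :: rat) \<in> \<int>" by (simp add: rat_mod_int.abs_eq_iff)
    then obtain k :: int where "(of_int s / 8 - of_int t / 8 :: rat) = of_int k" by (auto elim: Ints_cases)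
    then have "(of_int (s - t) :: rat) = of_int (8 * k)" by simp
    then have "s - t = 8 * k" by (simp only: of_int_eq_iff)
    moreover have "0 \<le> s" "s < 8" "0 \<le> t" "t < 8" using that by (auto simp: Q)
    ultimately show ?thesis by presburger
  qed
  ultimately have "Q (THE s. Q s)" by (metis theI')
  moreover have "signature q = (THE s. Q s)" unfolding signature_def Q_def ..
  ultimately show ?thesis by (simp add: Q)
qed

section \<open>The matrices of S and T, their relations and traces\<close>

definition S_op :: "((complex, 'd) vec, 'd) vec" where
  "S_op = (\<chi> x y. of_int \<epsilon> / 2 ^ m * e (bilin q x y))"

definition T_op :: "((complex, 'd) vec, 'd) vec" where
  "T_op = (\<chi> x y. if x = y then e (q x) else 0)"

lemma T_op_mult_nth: "(T_op ** A) $ x $ y = e (q x) * A $ x $ y"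
  and mult_T_op_nth: "(A ** T_op) $ x $ y = A $ x $ y * e (q y)"
  by (simp_all add: T_op_def matrix_matrix_mult_def
      if_distrib[of "\<lambda>c. c * _"] if_distrib[of "(*) _"] cong: if_cong)

text \<open>S^2 = 1 is orthogonality of characters, with x = -x and |D| = 4^m. For the braid
  relation, the (x,y) entry of STS is a Gauss sum twisted by x + y, and expanding
  \<open>e (q (x + y))\<close> gives the entry of TST.\<close>

sublocale braid_involutions S_op T_op
proof
  have four: "(2::complex) ^ m * 2 ^ m = 4 ^ m" by (simp add: power_mult_distrib [symmetric])
  show "S_op ** S_op = mat 1"
  proof -
    have "(S_op ** S_op) $ x $ y = (mat 1 :: ((complex, 'd) vec, 'd) vec) $ x $ y" for x y
    proof -
      have "(S_op ** S_op) $ x $ y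
          = of_int \<epsilon> * of_int \<epsilon> / (2 ^ m * 2 ^ m) * (\<Sum>z\<in>UNIV. e (bilin q (x + y) z))"
        by (simp add: S_op_def matrix_matrix_mult_def sum_distrib_left e_bilin_add_left
            bilin_commute[of q _ y] mult_ac)
      also have "\<dots> = (if x = y then 1 else 0)"
        by (simp add: sum_e_bilin add_eq_0_iff card_eq four)
      finally show ?thesis by (simp add: mat_def)
    qed
    then show ?thesis by (simp add: vec_eq_iff)
  qed
  show "T_op ** T_op = mat 1"
    by (simp add: vec_eq_iff T_op_mult_nth) (simp add: T_op_def mat_def)
  show "T_op ** (S_op ** T_op) = S_op ** (T_op ** S_op)"
  proof -
    have "(S_op ** (T_op ** S_op)) $ x $ y = (T_op ** (S_op ** T_op)) $ x $ y" for x y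
    proof -
      have "(S_op ** (T_op ** S_op)) $ x $ y
          = (\<Sum>z\<in>UNIV. S_op $ x $ z * (e (q z) * S_op $ z $ y))"
        by (simp add: matrix_matrix_mult_def[of S_op] T_op_mult_nth)
      also have "\<dots> = of_int \<epsilon> * of_int \<epsilon> / (2 ^ m * 2 ^ m) * (\<Sum>z\<in>UNIV. e (bilin q (x + y) z) * e (q z))"
        by (simp add: S_op_def sum_distrib_left e_bilin_add_left bilin_commute[of q _ y] mult_ac)
      also have "\<dots> = of_int \<epsilon> / 2 ^ m * e (q (x + y))"
        by (simp add: sum_e_bilin_q)
      also have "\<dots> = (T_op ** (S_op ** T_op)) $ x $ y"
        by (simp add: T_op_mult_nth mult_T_op_nth S_op_def e_quadratic_add)
      finally show ?thesis .
    qed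
    then show ?thesis by (simp add: vec_eq_iff)
  qed
qed

lemma trace_T_op: "trace T_op = of_int \<epsilon> * 2 ^ m"
  by (simp add: trace_def T_op_def gauss)

text \<open>\<open>S_op\<close> has constant diagonal because \<open>e (bilin q x x) = 1\<close>, so
  the trace is a multiple of the Gauss sum.\<close>

lemma trace_S_T: "trace (S_op ** T_op) = 1"
proof -
  have "trace (S_op ** T_op) = (\<Sum>x\<in>UNIV. of_int \<epsilon> / 2 ^ m * e (q x))"
    by (simp add: trace_def mult_T_op_nth S_op_def)
  also have "\<dots> = of_int \<epsilon> / 2 ^ m * (of_int \<epsilon> * 2 ^ m)"
    by (simp only: sum_distrib_left [symmetric] gauss)
  finally show ?thesis by simp
qed

section \<open>Existence and uniqueness of the Weil representation\<close>

lemma linear_eq_matrix: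
  assumes "Vector_Spaces.linear (*s) (*s) f" "\<And>x. f (axis x 1) = A *v axis x 1"
  shows "f = (*v) (A :: ((complex, 'd) vec, 'd) vec)"
proof -
  have "matrix f = matrix ((*v) A)" using assms(2) by (simp add: matrix_def)
  then show ?thesis using matrix_works[OF assms(1)] by (auto simp: fun_eq_iff)
qed

lemma S_op_axis: "S_op *v axis x 1 =
   (e (qz (of_int (signature q) / 8)) / of_real (sqrt (real CARD('d)))) *s
          (\<Sum>y\<in>UNIV. e (bilin q x y) *s axis y 1)"
proof -
  have "(\<Sum>y\<in>UNIV. e (bilin q x y) *s axis y 1) = (\<chi> y. e (bilin q x y))"
    using basis_expansion[of "\<chi> y. e (bilin q x y)"] by simp
  then show ?thesis
    by (simp add: vec_eq_iff e_signature sqrt_card S_op_def matrix_vector_mult_axis_nth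
        bilin_commute[of q x])
qed

lemma T_op_axis: "T_op *v axis x 1 = e (- q x) *s axis x 1"
  by (simp add: vec_eq_iff matrix_vector_mult_axis_nth e_minus_q) (simp add: T_op_def axis_def)

text \<open>The restriction supplies the extensionality demanded by \<open>is_weil_rep\<close>,
  which makes the representation unique as a function on all matrices.\<close>

definition \<rho> :: "int^2^2 \<Rightarrow> (complex, 'd) vec \<Rightarrow> (complex, 'd) vec" where
  "\<rho> = restrict (\<lambda>M. (*v) (mod2_word S_op T_op M)) SL2Z"

lemma \<rho>_S: "\<rho> S_mat = (*v) S_op" and \<rho>_T: "\<rho> T_mat = (*v) T_op"
  by (simp_all add: \<rho>_def mod2_word_def)

lemma is_weil_rep_\<rho>: "is_weil_rep q \<rho>"
  unfolding is_weil_rep_def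
proof (intro conjI ballI allI)
  show "\<rho> \<in> extensional SL2Z" by (simp add: \<rho>_def)
  show "\<rho> (mat 1) = id" by (simp add: \<rho>_def mod2_word_def fun_eq_iff)
  show "Vector_Spaces.linear (*s) (*s) (\<rho> M)" if "M \<in> SL2Z" for M
    using that by (simp add: \<rho>_def)
  show "\<rho> (M ** N) = \<rho> M \<circ> \<rho> N" if "M \<in> SL2Z" "N \<in> SL2Z" for M N
    using that by (simp add: \<rho>_def mod2_word_mult fun_eq_iff matrix_vector_mul_assoc)
qed (simp_all only: \<rho>_S \<rho>_T S_op_axis T_op_axis)

text \<open>Linearity and the values on basis vectors fix the operators of S and T, and these two
  matrices generate \<open>SL2Z\<close>.\<close>

lemma is_weil_rep_unique:
  assumes "is_weil_rep q \<sigma>"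
  shows "\<sigma> = \<rho>"
proof
  fix M
  have S: "\<sigma> S_mat = \<rho> S_mat" and T: "\<sigma> T_mat = \<rho> T_mat"
    unfolding \<rho>_S \<rho>_T using assms
    by (auto intro!: linear_eq_matrix simp: is_weil_rep_def S_op_axis T_op_axis)
  show "\<sigma> M = \<rho> M"
  proof (cases "M \<in> SL2Z")
    case True
    then show ?thesis
    proof (induction rule: SL2Z_induct)
      case one
      then show ?case using assms is_weil_rep_\<rho> by (simp add: is_weil_rep_def)
    next
      case (S N)
      then show ?case using assms is_weil_rep_\<rho> \<open>\<sigma> S_mat = \<rho> S_mat\<close> by (simp add: is_weil_rep_def)
    next
      case (T N)
      then show ?case using assms is_weil_rep_\<rho> \<open>\<sigma> T_mat = \<rho> T_mat\<close> by (simp add: is_weil_rep_def)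
    qed
  next
    case False
    then show ?thesis using assms by (simp add: \<rho>_def is_weil_rep_def extensional_def)
  qed
qed

lemma weil_rep_eq: "weil_rep q = \<rho>"
  unfolding weil_rep_def using is_weil_rep_\<rho> is_weil_rep_unique by (rule the_equality)

lemma weil_invariants_eq: "weil_invariants q = {v. S_op *v v = v \<and> T_op *v v = v}"
proof -
  have "\<rho> M v = v" if "S_op *v v = v" "T_op *v v = v" "M \<in> SL2Z" for M v
    using that by (simp add: \<rho>_def mod2_word_def matrix_vector_mul_assoc [symmetric])
  moreover have "S_op *v v = v \<and> T_op *v v = v" if "\<forall>M\<in>SL2Z. \<rho> M v = v" for v
    using that S_mat_in_SL2Z T_mat_in_SL2Z by (metis \<rho>_S \<rho>_T)
  ultimately show ?thesis
    unfolding weil_invariants_def weil_rep_eq by blast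
qed

lemma dim_weil_invariants:
  "real (vec.dim (weil_invariants q)) = (4 ^ m + 3 * of_int \<epsilon> * 2 ^ m + 2) / 6"
proof -
  \<comment> \<open>\<open>dim_fixed\<close> is an identity in the field of matrix entries, here the
    complex numbers.\<close>
  have "complex_of_real (real (vec.dim (weil_invariants q)))
      = of_real ((4 ^ m + 3 * of_int \<epsilon> * 2 ^ m + 2) / 6)"
    by (simp add: weil_invariants_eq dim_fixed trace_T_op trace_S_T card_eq)
  then show ?thesis by (simp only: of_real_eq_iff)
qed

end

theorem theorem4p4:
  fixes q :: "'d::{finite,ab_group_add} \<Rightarrow> rat_mod_int" and \<epsilon> :: int and n :: nat
  assumes "discriminant_form q" and "even n" and "type_2II q \<epsilon> n"
  shows "real (vec.dim (weil_invariants q)) =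
    (2 powr (real n - 1) + 1) / 3 + of_int \<epsilon> * 2 powr ((real n - 2) / 2)"
proof -
  obtain m where n: "n = 2 * m" using assms(2) by (elim evenE)
  interpret weil_2II q \<epsilon> m
    using type_2II_imp_weil_2II[OF assms(1,3)] by (simp add: n)
  \<comment> \<open>The powers are written as halves because the exponents n - 1 and m - 1 are
    negative for n = 0.\<close>
  have pow_n: "(2::real) powr (real n - 1) = 4 ^ m / 2"
    by (simp add: n powr_diff powr_realpow [symmetric] powr_powr [symmetric])
  have half: "(real n - 2) / 2 = real m - 1" by (simp add: n)
  have pow_half: "(2::real) powr ((real n - 2) / 2) = 2 ^ m / 2"
    unfolding half by (simp add: powr_diff powr_realpow)
  show ?thesis
    unfolding dim_weil_invariants pow_n pow_half by (simp add: field_simps)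
qed

end
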